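(* Let $y$ and $z$ be two distinct nonnegative integers and let $n$ be an odd prime. Let $p$ be an odd prime different from $n$ and relatively prime to $y$. Let $r$ be a primitive root modulo $p^2$ and let $m$ be a positive integer. Then $p^m$ divides $\dfrac{z^n-y^n}{z-y}$ if and only if $n$ divides $p-1$ and there exists an integer $c$ with $0<c<p-1$ and $p-1$ dividing $nc$ such that $$z \equiv y\, r^{c p^{m-1}} \pmod{p^m}.$$
   Context: An integer $r$ is a primitive root modulo a positive integer $N$ if $r$ is relatively prime to $N$ and the smallest positive integer $a$ with $r^a\equiv 1 \pmod N$ is $\phi(N)$, where $\phi$ is Euler's totient function. *)

theory Defs
  imports "HOL-Number_Theory.Number_Theory"
begin

text \<open>
  The library predicate \<^const>\<open>residue_primroot\<close> is restricted to natural numbers, whereas a primitive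
  root is an arbitrary (possibly negative) integer here. The set of exponents below is nonempty
  for \<open>N > 0\<close> and \<open>r\<close> coprime to \<open>N\<close>, so \<open>LEAST\<close> really is the smallest such exponent.
\<close>

definition primitive_root :: "nat \<Rightarrow> int \<Rightarrow> bool" where
  "primitive_root N r \<longleftrightarrow> N > 0 \<and> coprime r (int N) \<and>
     (LEAST a::nat. a > 0 \<and> [r ^ a = 1] (mod int N)) = totient N"

lemma primitive_root_of_nat_iff: "primitive_root N (int g) \<longleftrightarrow> residue_primroot N g"
proof (cases "N > 0 \<and> coprime N g")
  case True
  have ord: "[g ^ ord N g = 1] (mod N)" "ord N g > 0"
    using True ord_works by (auto simp: coprime_commute)
  have eq: "[int g ^ a = 1] (mod int N) \<longleftrightarrow> [g ^ a = 1] (mod N)" for a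
    by (metis cong_int_iff of_nat_1 of_nat_power)
  have "(LEAST a. a > 0 \<and> [g ^ a = 1] (mod N)) = ord N g"
    by (rule Least_equality) (use ord ord_minimal in \<open>auto simp: not_less[symmetric]\<close>)
  with True show ?thesis
    unfolding primitive_root_def residue_primroot_def eq
    by (simp add: coprime_commute)
qed (auto simp: primitive_root_def residue_primroot_def coprime_commute)

end

theory Submission
  imports Defs
begin

text \<open>
  Two independent observations give the result.

  First, \<open>z ^ n - y ^ n\<close> factors as \<open>z - y\<close> times a sum of \<open>n\<close> monomials of degree \<open>n - 1\<close>. If
  \<open>p\<close> divides \<open>z - y\<close>, that sum is congruent to \<open>n * y ^ (n - 1)\<close>, a unit modulo \<open>p\<close>; otherwise
  \<open>z - y\<close> is a unit modulo \<open>p ^ m\<close> and can be cancelled. So the divisibility says exactly that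
  \<open>z ^ n\<close> and \<open>y ^ n\<close> agree modulo \<open>p ^ m\<close> while \<open>z\<close> and \<open>y\<close> differ modulo \<open>p\<close>
  (\<open>prime_power_dvd_power_diff_quotient_iff\<close>).

  Second, a primitive root modulo \<open>p\<^sup>2\<close> is a primitive root modulo every power of \<open>p\<close>
  (\<open>residue_primroot_prime_square_imp_power\<close>), so \<open>z / y\<close> is a power \<open>r ^ i\<close> modulo \<open>p ^ m\<close>.
  It is an \<open>n\<close>-th root of unity iff \<open>p ^ (m - 1) * (p - 1)\<close> divides \<open>n * i\<close>; as \<open>n\<close> is prime
  to \<open>p\<close>, the exponent \<open>i\<close> must be of the form \<open>c * p ^ (m - 1)\<close> with \<open>p - 1\<close> dividing
  \<open>n * c\<close>. Such a root of unity is trivial modulo \<open>p\<close> iff \<open>p - 1\<close> divides \<open>c\<close>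
  (\<open>root_of_unity_quotient_iff_primroot_power\<close>). Since \<open>n\<close> is prime, a nontrivial
  one can only exist if \<open>n\<close> divides \<open>p - 1\<close>.
\<close>

section \<open>Primitive roots modulo prime powers\<close>

lemma primitive_root_cong:
  assumes "[r = s] (mod int N)"
  shows   "primitive_root N r \<longleftrightarrow> primitive_root N s"
proof -
  have "coprime r (int N) \<longleftrightarrow> coprime s (int N)"
    using assms by (metis cong_imp_coprime cong_sym)
  moreover have "[r ^ a = 1] (mod int N) \<longleftrightarrow> [s ^ a = 1] (mod int N)" for a
    using cong_pow[OF assms, of a] by (simp add: cong_def)
  ultimately show ?thesis
    unfolding primitive_root_def by simp
qed

lemma residue_primroot_discrete_log:
  fixes N g x :: nat
  assumes N: "N > 1" and g: "residue_primroot N g" and x: "coprime x N"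
  obtains i where "i < totient N" "[x = g ^ i] (mod N)"
proof -
  have "coprime (x mod N) N"
    using x N by (simp add: coprime_mod_left_iff)
  moreover have "x mod N \<le> N"
    using mod_less_divisor[of N x] N by linarith
  moreover have "x mod N > 0"
    using \<open>coprime (x mod N) N\<close> N by (auto intro!: Nat.gr0I)
  ultimately have "x mod N \<in> totatives N"
    by (simp add: totatives_def)
  also have "totatives N = (\<lambda>i. g ^ i mod N) ` {..<totient N}"
    using residue_primroot_is_generator[OF N g] by (simp add: bij_betw_def)
  finally show ?thesis
    using that by (auto simp: cong_def)
qed

text \<open>
  Reduction maps the cyclic group of units modulo \<open>p\<^sup>2\<close> onto the one modulo \<open>p\<close>, so the image of
  a generator generates: a primitive root \<open>h\<close> modulo \<open>p\<close>, being a unit modulo \<open>p\<^sup>2\<close>, is a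
  power of \<open>g\<close>, whence the order of \<open>h\<close> divides that of \<open>g\<close>.
\<close>
lemma residue_primroot_prime_square_imp_prime:
  fixes p g :: nat
  assumes p: "prime p" and g: "residue_primroot (p\<^sup>2) g"
  shows   "residue_primroot p g"
proof -
  have gt: "p\<^sup>2 > 1"
    using one_less_power[OF prime_gt_1_nat[OF p]] by simp
  have cop: "coprime p g"
    using g by (simp add: residue_primroot_def)
  obtain h where h: "residue_primroot p h"
    using prime_primitive_root_exists[of p] p prime_gt_1_nat[OF p] by auto
  have "coprime h (p\<^sup>2)"
    using h by (simp add: residue_primroot_def coprime_commute)
  then obtain i where "[h = g ^ i] (mod p\<^sup>2)"
    by (rule residue_primroot_discrete_log[OF gt g])
  hence hi: "[h = g ^ i] (mod p)"
    by (metis cong_modulus_mult_nat power2_eq_square)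
  have "[h ^ ord p g = (g ^ i) ^ ord p g] (mod p)"
    by (rule cong_pow[OF hi])
  also have "(g ^ i) ^ ord p g = (g ^ ord p g) ^ i"
    by (simp add: power_mult [symmetric] mult.commute)
  also have "[\<dots> = 1 ^ i] (mod p)"
    by (rule cong_pow[OF ord])
  finally have "ord p h dvd ord p g"
    by (simp add: ord_divides')
  hence "totient p dvd ord p g"
    using h by (simp add: residue_primroot_def)
  thus ?thesis
    using order_divides_totient[OF cop] cop prime_gt_0_nat[OF p]
    by (auto simp: residue_primroot_def intro: dvd_antisym)
qed

text \<open>
  Modulo \<open>p\<^sup>2\<close> the order of \<open>g\<close> exceeds \<open>p - 1\<close>, which is the condition under which a primitive
  root modulo \<open>p\<close> lifts to all powers of \<open>p\<close>.
\<close>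
lemma residue_primroot_prime_square_imp_power:
  fixes p g :: nat
  assumes p: "prime p" "odd p" and g: "residue_primroot (p\<^sup>2) g" and k: "k > 0"
  shows   "residue_primroot (p ^ k) g"
proof -
  have "ord (p\<^sup>2) g = p * (p - 1)"
    using g p by (simp add: residue_primroot_def totient_prime_power)
  hence "[g ^ (p - 1) \<noteq> 1] (mod p\<^sup>2)"
    using prime_gt_1_nat[OF p(1)] by (auto simp: ord_divides' dest!: dvd_imp_le)
  thus ?thesis
    using residue_primroot_prime_lift_iff[OF p residue_primroot_prime_square_imp_prime[OF p(1) g]] k
    by blast
qed

section \<open>The quotient of a difference of powers\<close>

text \<open>
  The cofactor \<open>S\<close> of \<open>x - y\<close> in \<open>x ^ n - y ^ n\<close> and \<open>x - y\<close> itself are never both divisible by \<open>p\<close>: for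
  \<open>x\<close> congruent to \<open>y\<close> each of the \<open>n\<close> terms of \<open>S\<close> becomes \<open>y ^ (n - 1)\<close>. A power of
  \<open>p\<close> dividing \<open>(x - y) * S\<close> therefore divides one of the two factors.
\<close>
lemma prime_power_dvd_power_diff_quotient_iff:
  fixes x y p :: int
  assumes xy: "x \<noteq> y" and p: "prime p" and pn: "\<not> p dvd int n" and py: "\<not> p dvd y" and m: "m > 0"
  shows "p ^ m dvd (x ^ n - y ^ n) div (x - y) \<longleftrightarrow> [x ^ n = y ^ n] (mod p ^ m) \<and> \<not> [x = y] (mod p)"
proof -
  define S where "S = (\<Sum>i<n. y ^ (n - Suc i) * x ^ i)"
  have eq: "x ^ n - y ^ n = (x - y) * S"
    unfolding S_def by (rule power_diff_sumr2)
  have quot: "(x ^ n - y ^ n) div (x - y) = S"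
    using xy by (simp add: eq)
  have unit: "\<not> p dvd S" if "[x = y] (mod p)"
  proof -
    have "[S = (\<Sum>i<n. y ^ (n - Suc i) * y ^ i)] (mod p)"
      unfolding S_def by (intro cong_sum cong_mult cong_pow that cong_refl)
    also have "(\<Sum>i<n. y ^ (n - Suc i) * y ^ i) = (\<Sum>i<n. y ^ (n - 1))"
      by (intro sum.cong refl) (simp add: power_add [symmetric])
    finally have "[S = int n * y ^ (n - 1)] (mod p)"
      by simp
    moreover have "\<not> p dvd int n * y ^ (n - 1)"
      using p pn py by (metis prime_dvd_multD prime_dvd_power)
    ultimately show ?thesis
      using cong_dvd_iff by blast
  qed
  have "p ^ m dvd (x - y) * S \<longleftrightarrow> p ^ m dvd S" if "\<not> [x = y] (mod p)"
  proof -
    have "coprime (p ^ m) (x - y)"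
      using that p m by (simp add: cong_iff_dvd_diff prime_imp_coprime)
    thus ?thesis
      by (simp add: coprime_dvd_mult_right_iff)
  qed
  moreover have "p dvd S" if "p ^ m dvd S"
    using that m by (meson dvd_power dvd_trans)
  ultimately show ?thesis
    unfolding quot using unit by (auto simp: cong_iff_dvd_diff eq)
qed

section \<open>Roots of unity as powers of a primitive root\<close>

text \<open>
  Write \<open>z / y = g ^ i\<close>. Being an \<open>n\<close>-th root of unity modulo \<open>p ^ m\<close> means that the order
  \<open>p ^ (m - 1) * (p - 1)\<close> of \<open>g\<close> divides \<open>i * n\<close>. Since \<open>n\<close> contributes no factor \<open>p\<close>, the
  whole power \<open>p ^ (m - 1)\<close> sits in \<open>i\<close>, and only \<open>p - 1\<close> is shared between \<open>n\<close> and the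
  cofactor \<open>c\<close>. Nontriviality modulo \<open>p\<close>, where \<open>g\<close> has order \<open>p - 1\<close>, excludes \<open>c = 0\<close>.
\<close>
lemma root_of_unity_quotient_iff_primroot_power:
  fixes y z n p m g :: nat
  assumes p: "prime p" "odd p" and g: "residue_primroot (p\<^sup>2) g"
    and pn: "coprime p n" and py: "coprime p y" and m: "m > 0"
  shows "[z ^ n = y ^ n] (mod p ^ m) \<and> \<not> [z = y] (mod p) \<longleftrightarrow>
    (\<exists>c. 0 < c \<and> c < p - 1 \<and> p - 1 dvd n * c \<and> [z = y * g ^ (c * p ^ (m - 1))] (mod p ^ m))"
    (is "?L \<longleftrightarrow> ?R")
proof -
  define P where "P = p ^ (m - 1)"
  have Pm: "p ^ m = p * P"
    using m by (cases m) (auto simp: P_def)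
  have P0: "P > 0"
    using prime_gt_0_nat[OF p(1)] by (simp add: P_def)
  have gm: "residue_primroot (p ^ m) g" and gp: "residue_primroot p g"
    using residue_primroot_prime_square_imp_power[OF p g] m
          residue_primroot_prime_square_imp_prime[OF p(1) g] by auto
  have ordm: "ord (p ^ m) g = P * (p - 1)"
    using gm p m by (simp add: residue_primroot_def totient_prime_power P_def)
  have ordp: "ord p g = p - 1"
    using gp p by (simp add: residue_primroot_def totient_prime)
  have pm1: "p ^ m > 1"
    using one_less_power[OF prime_gt_1_nat[OF p(1)] m] .
  have mod_p: "[a = b] (mod p)" if "[a = b] (mod p ^ m)" for a b :: nat
    using that unfolding Pm by (rule cong_modulus_mult_nat)
  have cop_p1: "coprime (p - 1) P"
    unfolding P_def
    by (intro coprime_power_right_iff[THEN iffD2] disjI1 coprime_diff_one_left_nat prime_gt_0_nat p)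
  show ?thesis
  proof
    assume L: ?L
    \<comment> \<open>With \<open>y'\<close> inverse to \<open>y\<close>, the product \<open>z * y'\<close> plays the role of \<open>z / y\<close>.\<close>
    obtain y' where y': "[y * y' = 1] (mod p ^ m)"
      using cong_solve_coprime_nat[of y "p ^ m"] py by (auto simp: coprime_commute)
    have "[(z * y') ^ n = (y * y') ^ n] (mod p ^ m)"
      unfolding power_mult_distrib by (intro cong_mult cong_refl) (use L in auto)
    also have "[(y * y') ^ n = 1 ^ n] (mod p ^ m)"
      by (rule cong_pow[OF y'])
    finally have un: "[(z * y') ^ n = 1] (mod p ^ m)"
      by simp
    have "n > 0"
      using pn prime_gt_1_nat[OF p(1)] by (auto intro!: Nat.gr0I)
    have "coprime ((z * y') ^ n) (p ^ m)"
      by (rule cong_imp_coprime[OF cong_sym[OF un]]) simp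
    hence "coprime (z * y') (p ^ m)"
      using \<open>n > 0\<close> by (simp only: coprime_power_left_iff) simp
    then obtain i where "i < totient (p ^ m)" and gi: "[z * y' = g ^ i] (mod p ^ m)"
      by (rule residue_primroot_discrete_log[OF pm1 gm])
    hence i: "i < P * (p - 1)"
      using p m by (simp add: totient_prime_power P_def)
    have "[g ^ (i * n) = (z * y') ^ n] (mod p ^ m)"
      using cong_pow[OF gi, of n] by (simp add: power_mult cong_sym)
    also note un
    finally have dvd: "P * (p - 1) dvd i * n"
      by (simp add: ord_divides' ordm)
    have "coprime P n"
      using pn by (simp add: P_def)
    hence "P dvd i"
      using dvd by (metis coprime_dvd_mult_left_iff dvd_mult_left)
    then obtain c where c: "i = c * P"
      by (metis dvd_def mult.commute)
    have "[z * (y * y') = z * 1] (mod p ^ m)"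
      by (intro cong_mult y' cong_refl)
    hence "[z = y * (z * y')] (mod p ^ m)"
      by (simp add: cong_sym_eq mult_ac)
    also have "[y * (z * y') = y * g ^ i] (mod p ^ m)"
      by (intro cong_mult gi cong_refl)
    finally have zc: "[z = y * g ^ (c * P)] (mod p ^ m)"
      by (simp add: c)
    have "c \<noteq> 0"
      using L mod_p[OF zc] by (intro notI) simp
    moreover have "c < p - 1"
      using i P0 by (simp add: c mult.commute)
    moreover have "p - 1 dvd n * c"
      using dvd P0 by (simp add: c mult_ac)
    ultimately show ?R
      using zc unfolding P_def by blast
  next
    assume ?R
    then obtain c where c: "0 < c" "c < p - 1" "p - 1 dvd n * c"
      and zc: "[z = y * g ^ (c * P)] (mod p ^ m)"
      unfolding P_def by blast
    have "[z ^ n = (y * g ^ (c * P)) ^ n] (mod p ^ m)"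
      by (rule cong_pow[OF zc])
    also have "(y * g ^ (c * P)) ^ n = y ^ n * g ^ (P * (n * c))"
      by (simp add: power_mult_distrib power_mult [symmetric] mult_ac)
    also have "[y ^ n * g ^ (P * (n * c)) = y ^ n * 1] (mod p ^ m)"
    proof (intro cong_mult cong_refl)
      show "[g ^ (P * (n * c)) = 1] (mod p ^ m)"
        unfolding ord_divides ordm using c(3) by (rule mult_dvd_mono[OF dvd_refl])
    qed
    finally have "[z ^ n = y ^ n] (mod p ^ m)"
      by simp
    moreover have "\<not> [z = y] (mod p)"
    proof
      assume "[z = y] (mod p)"
      hence "[y * g ^ (c * P) = y * 1] (mod p)"
        using mod_p[OF zc] by (metis cong_sym cong_trans mult.right_neutral)
      hence "[g ^ (c * P) = 1] (mod p)"
        using py by (simp only: cong_mult_lcancel_nat coprime_commute)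
      hence "p - 1 dvd c * P"
        by (simp add: ord_divides' ordp)
      hence "p - 1 dvd c"
        using cop_p1 by (simp add: coprime_dvd_mult_left_iff)
      thus False
        using c(1,2) by (auto dest!: dvd_imp_le)
    qed
    ultimately show ?L by blast
  qed
qed

lemma prime_factor_dvd_of_dvd_mult_less:
  fixes q n c :: nat
  assumes "prime n" "q dvd n * c" "0 < c" "c < q"
  shows   "n dvd q"
proof (rule ccontr)
  assume "\<not> n dvd q"
  hence "coprime q n"
    using assms(1) by (simp add: prime_imp_coprime coprime_commute)
  hence "q dvd c"
    using assms(2) by (simp add: coprime_dvd_mult_right_iff)
  thus False
    using assms(3,4) by (auto dest!: dvd_imp_le)
qed

section \<open>Divisibility of the quotient by a prime power\<close>

theorem theorem2p3:
  fixes y z n p m :: nat and r :: int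
  assumes "y \<noteq> z"
    and "prime n" and "odd n"
    and "prime p" and "odd p" and "p \<noteq> n" and "coprime p y"
    and "primitive_root (p\<^sup>2) r"
    and "m > 0"
  shows "int (p ^ m) dvd (int z ^ n - int y ^ n) div (int z - int y) \<longleftrightarrow>
    n dvd p - 1 \<and>
    (\<exists>c::nat. 0 < c \<and> c < p - 1 \<and> p - 1 dvd n * c \<and>
       [int z = int y * r ^ (c * p ^ (m - 1))] (mod int (p ^ m)))"
proof -
  \<comment> \<open>The natural number \<open>g\<close> has to represent \<open>r\<close> modulo both \<open>p\<^sup>2\<close> and \<open>p ^ m\<close>; as \<open>m > 0\<close>, both
      divide \<open>p ^ (m + 1)\<close>.\<close>
  define g where "g = nat (r mod int (p ^ (m + 1)))"
  have pos: "int (p ^ (m + 1)) > 0"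
    using prime_gt_0_nat[OF \<open>prime p\<close>] by simp
  have "int g = r mod int (p ^ (m + 1))"
    unfolding g_def using pos by (intro int_nat_eq[THEN trans]) (simp del: of_nat_power)
  hence rg: "[r = int g] (mod int (p ^ (m + 1)))"
    by (simp add: cong_def)
  have rg2: "[r = int g] (mod int (p\<^sup>2))"
  proof (rule cong_dvd_modulus[OF rg])
    have "p ^ 2 dvd p ^ (m + 1)"
      using \<open>m > 0\<close> by (intro le_imp_power_dvd) simp
    thus "int (p\<^sup>2) dvd int (p ^ (m + 1))"
      by (simp only: of_nat_dvd_iff)
  qed
  have rgm: "[r = int g] (mod int (p ^ m))"
    by (rule cong_dvd_modulus[OF rg]) simp
  have g: "residue_primroot (p\<^sup>2) g"
    using assms(8) primitive_root_cong[OF rg2] by (simp only: primitive_root_of_nat_iff)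
  have pn: "coprime p n"
    using assms(2,4,6) by (simp add: primes_coprime)
  have pn': "\<not> int p dvd int n"
    using assms(2,4,6) by (simp add: primes_dvd_imp_eq) (metis primes_dvd_imp_eq)
  have py': "\<not> int p dvd int y"
    using assms(4,7) by (metis coprime_absorb_left int_dvd_int_iff not_prime_unit)
  have expo: "[int z = int y * r ^ e] (mod int (p ^ m)) \<longleftrightarrow> [z = y * g ^ e] (mod p ^ m)" for e
  proof -
    have "[int y * r ^ e = int y * int g ^ e] (mod int (p ^ m))"
      by (intro cong_mult cong_pow rgm cong_refl)
    hence "[int z = int y * r ^ e] (mod int (p ^ m)) \<longleftrightarrow>
           [int z = int (y * g ^ e)] (mod int (p ^ m))"
      by (simp add: cong_def)
    thus ?thesis
      by (simp only: cong_int_iff)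
  qed
  have "int (p ^ m) dvd (int z ^ n - int y ^ n) div (int z - int y) \<longleftrightarrow>
        [int z ^ n = int y ^ n] (mod int p ^ m) \<and> \<not> [int z = int y] (mod int p)"
    using prime_power_dvd_power_diff_quotient_iff[of "int z" "int y" "int p" n m] assms pn' py'
    by simp
  also have "\<dots> \<longleftrightarrow> [z ^ n = y ^ n] (mod p ^ m) \<and> \<not> [z = y] (mod p)"
    by (simp only: cong_int_iff flip: of_nat_power)
  also have "\<dots> \<longleftrightarrow> (\<exists>c. 0 < c \<and> c < p - 1 \<and> p - 1 dvd n * c \<and>
                         [z = y * g ^ (c * p ^ (m - 1))] (mod p ^ m))"
    using assms pn g by (intro root_of_unity_quotient_iff_primroot_power) auto
  also have "\<dots> \<longleftrightarrow> n dvd p - 1 \<and> (\<exists>c. 0 < c \<and> c < p - 1 \<and> p - 1 dvd n * c \<and>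
                         [z = y * g ^ (c * p ^ (m - 1))] (mod p ^ m))"
    using prime_factor_dvd_of_dvd_mult_less[OF \<open>prime n\<close>] by blast
  finally show ?thesis
    unfolding expo .
qed

end
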